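(* Let $O\subset\mathbb{R}^3$ be an octant, i.e. a set of the form $\{(x_1,x_2,x_3)\in\mathbb{R}^3:\ \varepsilon_i x_i\ge 0 \text{ for } i=1,2,3\}$ for some fixed signs $\varepsilon_1,\varepsilon_2,\varepsilon_3\in\{-1,1\}$, and let $k\ge 2$ be an integer. Then every finite set $P\subset\mathbb{R}^3$ can be colored with $k$ colors such that every translate $O+v$ ($v\in\mathbb{R}^3$) containing at least $12^{2^{k-1}+2^{k-2}-2}$ points of $P$ contains points of $P$ of all $k$ colors. *)

theory Defs
  imports "HOL-Analysis.Analysis"
begin

definition is_octant :: "(real ^ 3) set \<Rightarrow> bool" where
  "is_octant S \<longleftrightarrow>
     (\<exists>\<epsilon> :: 3 \<Rightarrow> real. (\<forall>i. \<epsilon> i \<in> {-1, 1}) \<and> S = {x. \<forall>i. \<epsilon> i * x $ i \<ge> 0})"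

definition translate :: "'a::ab_group_add set \<Rightarrow> 'a \<Rightarrow> 'a set" where
  "translate S v = (\<lambda>x. x + v) ` S"

text \<open>The colors are the numbers \<open>0, \<dots>, k - 1\<close>; values of a coloring outside \<open>P\<close> are
  irrelevant, and colors need not all be used.\<close>

definition is_coloring :: "nat \<Rightarrow> 'a set \<Rightarrow> ('a \<Rightarrow> nat) \<Rightarrow> bool" where
  "is_coloring k P c \<longleftrightarrow> (\<forall>p\<in>P. c p < k)"

end

theory Submission
  imports Defs
begin

text \<open>
  Breaking ties turns the octants into the sets cut out by three initial segments, one for each
  of three linear orders of \<open>P\<close>.

  Two colors, when no point of \<open>P\<close> lies below another in all three orders: insert the points in
  the third order and maintain a set of edges whose endpoints have to receive different colors,
  such that every wedge (the part of an octant inserted so far) with at least 12 points contains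
  an edge. The edges form a forest because each one is added while one of its endpoints is still
  free, i.e. its color can still be chosen independently of all other free points. The free points
  always lie on the staircase of minimal points of the plane projection. A new point is joined to
  all free points above it. If a wedge with at least 12 points still has no edge, it contains four
  consecutive free points \<open>a, b, c, e\<close> of the staircase for which the new edges \<open>b - a\<close> and
  \<open>c - e\<close> put an edge below each point above \<open>b\<close> or \<open>c\<close>. As a consequence an edgeless wedge never
  contains more than two points that are not free, and this is what makes the number 12 suffice.

  More colors, no point below another: the points of one color in an octant with fewer than \<open>n\<close>
  points of the other color are covered by \<open>n\<^sup>2\<close> octants without points of that other color,
  so each color occurs at least \<open>n\<close> times in every octant with \<open>12 n\<^sup>2\<close> points, and one
  can color one of the two classes recursively.

  Arbitrary \<open>P\<close>: color the minimal points with all \<open>k\<close> colors. Each other point lies above a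
  minimal point of some color \<open>\<kappa>\<close>; the points with the same \<open>\<kappa>\<close> are colored recursively with the
  remaining \<open>k - 1\<close> colors.
\<close>

section \<open>Wedges and edges\<close>

definition below :: "('a \<Rightarrow> nat) \<Rightarrow> ('a \<Rightarrow> nat) \<Rightarrow> 'a \<Rightarrow> 'a \<Rightarrow> bool" where
  "below x y p q \<longleftrightarrow> x p < x q \<and> y p < y q"

definition wedge :: "('a \<Rightarrow> nat) \<Rightarrow> ('a \<Rightarrow> nat) \<Rightarrow> 'a set \<Rightarrow> nat \<Rightarrow> nat \<Rightarrow> 'a set" where
  "wedge x y P X Y = {p \<in> P. x p < X \<and> y p < Y}"

definition has_edge :: "('a \<times> 'a) set \<Rightarrow> 'a set \<Rightarrow> bool" where
  "has_edge F W \<longleftrightarrow> (\<exists>(u, v) \<in> F. u \<in> W \<and> v \<in> W)"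

definition minimal_in :: "('a \<Rightarrow> nat) \<Rightarrow> ('a \<Rightarrow> nat) \<Rightarrow> 'a set \<Rightarrow> 'a \<Rightarrow> bool" where
  "minimal_in x y P s \<longleftrightarrow> s \<in> P \<and> (\<forall>q\<in>P. \<not> below x y q s)"

text \<open>This encodes the forest argument without speaking of cycles: arbitrary colors on
  \<open>A\<close> extend to a coloring that is proper for \<open>F\<close>.\<close>

definition freely_colorable :: "('a \<times> 'a) set \<Rightarrow> 'a set \<Rightarrow> bool" where
  "freely_colorable F A \<longleftrightarrow>
     (\<forall>g. \<exists>c :: 'a \<Rightarrow> bool. (\<forall>(u, v)\<in>F. c u \<noteq> c v) \<and> (\<forall>a\<in>A. c a = g a))"

text \<open>The state of the sweep: \<open>P\<close> contains the points inserted so far, \<open>F\<close> the edges, and \<open>A\<close> the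
  free points together with everything not yet inserted.\<close>

definition sweep_state ::
    "('a \<Rightarrow> nat) \<Rightarrow> ('a \<Rightarrow> nat) \<Rightarrow> 'a set \<Rightarrow> ('a \<times> 'a) set \<Rightarrow> 'a set \<Rightarrow> bool" where
  "sweep_state x y P F A \<longleftrightarrow>
     freely_colorable F A \<and> - P \<subseteq> A \<and>
     (\<forall>a \<in> A \<inter> P. minimal_in x y P a) \<and>
     (\<forall>d \<in> P - A. \<forall>u\<in>P. below x y d u \<longrightarrow> has_edge F (wedge x y P (Suc (x u)) (Suc (y u)))) \<and>
     (\<forall>X Y. \<not> has_edge F (wedge x y P X Y) \<longrightarrow> card (wedge x y P X Y - A) \<le> 2)"

lemma freely_colorableE:
  assumes "freely_colorable F A"
  obtains col :: "'a \<Rightarrow> bool" where "\<forall>(u, v)\<in>F. col u \<noteq> col v" "\<forall>a\<in>A. col a = g a"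
proof -
  have "\<exists>col. (\<forall>(u, v)\<in>F. col u \<noteq> col v) \<and> (\<forall>a\<in>A. col a = g a)"
    using assms by (simp add: freely_colorable_def)
  then show ?thesis
    by (elim exE conjE) (rule that)
qed

lemma has_edge_mono: "has_edge F W \<Longrightarrow> F \<subseteq> F' \<Longrightarrow> W \<subseteq> W' \<Longrightarrow> has_edge F' W'"
  unfolding has_edge_def by fast

lemma wedge_below_subset:
  "u \<in> wedge x y P X Y \<Longrightarrow> wedge x y P (Suc (x u)) (Suc (y u)) \<subseteq> wedge x y P X Y"
  by (auto simp: wedge_def)

lemma ex_minimal_in:
  assumes "p \<in> P"
  shows "\<exists>s. minimal_in x y P s \<and> (s = p \<or> below x y s p)"
  using assms
proof (induction "x p" arbitrary: p rule: less_induct)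
  case less
  show ?case
  proof (cases "minimal_in x y P p")
    case False
    then obtain q where q: "q \<in> P" "below x y q p"
      using less.prems by (auto simp: minimal_in_def)
    then obtain s where "minimal_in x y P s" "s = q \<or> below x y s q"
      using less.hyps[of q] by (auto simp: below_def)
    with q show ?thesis
      by (force simp: below_def)
  qed auto
qed

lemma staircase_order:
  assumes "minimal_in x y P a" "minimal_in x y P b" "inj_on y P" "x a < x b"
  shows "y b < y a"
proof -
  have "y a \<noteq> y b"
    using assms by (auto simp: minimal_in_def inj_on_def)
  moreover have "\<not> y a < y b"
    using assms by (auto simp: minimal_in_def below_def)
  ultimately show ?thesis by simp
qed

section \<open>Two colors\<close>

text \<open>\<open>b\<close> and \<open>c\<close> give up their freedom and take the colors opposite
  to those of \<open>a\<close> and \<open>e\<close>, which stay free. A wedge that meets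
  \<open>{b, c}\<close> but contains neither new edge is cut off before \<open>a\<close> and before
  \<open>e\<close>, so \<open>b\<close> and \<open>c\<close> are its only possible staircase points.
  Every other point in it would lie above one of them and hence have an edge below it.\<close>

lemma sweep_state_quad:
  assumes st: "sweep_state x y P F A" and inj: "inj_on x P" "inj_on y P"
    and A: "a \<in> A \<inter> P" "b \<in> A \<inter> P" "c \<in> A \<inter> P" "e \<in> A \<inter> P"
    and x: "x a < x b" "x b < x c" "x c < x e"
    and consecutive: "\<And>s. minimal_in x y P s \<Longrightarrow> x a < x s \<Longrightarrow> x s < x e \<Longrightarrow> s = b \<or> s = c"
    and above: "\<And>u. u \<in> P \<Longrightarrow> below x y b u \<or> below x y c u \<Longrightarrow> below x y a u \<or> below x y e u"
  shows "sweep_state x y P (F \<union> {(b, a), (c, e)}) (A - {b, c})"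
proof -
  let ?F = "F \<union> {(b, a), (c, e)}" and ?A = "A - {b, c}"
  have min: "minimal_in x y P a" "minimal_in x y P b" "minimal_in x y P c" "minimal_in x y P e"
    using st A by (auto simp: sweep_state_def)
  have y: "y b < y a" "y c < y b" "y e < y c"
    using min inj(2) x by (auto intro: staircase_order)
  have neq: "a \<noteq> b" "a \<noteq> c" "e \<noteq> b" "e \<noteq> c" "b \<noteq> c"
    using x by auto
  have "\<exists>col. (\<forall>(u, v)\<in>?F. col u \<noteq> col v) \<and> (\<forall>v\<in>?A. col v = g v)" for g :: "'a \<Rightarrow> bool"
  proof -
    define g' where "g' = g(b := \<not> g a, c := \<not> g e)"
    have "freely_colorable F A"
      using st by (simp add: sweep_state_def)
    then obtain col where F: "\<forall>(u, v)\<in>F. col u \<noteq> col v" and col: "\<forall>v\<in>A. col v = g' v"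
      by (rule freely_colorableE)
    have "col a = g' a" "col b = g' b" "col c = g' c" "col e = g' e"
      using A col by blast+
    then have "\<forall>(u, v)\<in>?F. col u \<noteq> col v"
      using F neq by (simp add: g'_def)
    moreover have "\<forall>v\<in>?A. col v = g v"
      using col by (simp add: g'_def)
    ultimately show ?thesis
      by blast
  qed
  then have free: "freely_colorable ?F ?A"
    by (simp add: freely_colorable_def)
  have edge: "has_edge ?F (wedge x y P (Suc (x u)) (Suc (y u)))"
    if u: "u \<in> P" and d: "d \<in> P - ?A" and du: "below x y d u" for d u
  proof (cases "d \<in> A")
    case False
    then have "has_edge F (wedge x y P (Suc (x u)) (Suc (y u)))"
      using st u d du by (auto simp: sweep_state_def)
    then show ?thesis
      by (rule has_edge_mono) auto
  next
    case True
    then have "below x y b u \<or> below x y c u"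
      using d du by auto
    \<comment> \<open>The staircase order repairs the mixed cases: a point above \<open>b\<close>
      and \<open>e\<close> is above \<open>c\<close>, and a point above \<open>c\<close> and
      \<open>a\<close> is above \<open>b\<close>.\<close>
    then have "below x y b u \<and> below x y a u \<or> below x y c u \<and> below x y e u"
      using above[OF u] x y by (auto simp: below_def)
    then have "{a, b} \<subseteq> wedge x y P (Suc (x u)) (Suc (y u)) \<or>
               {c, e} \<subseteq> wedge x y P (Suc (x u)) (Suc (y u))"
      using A by (auto simp: below_def wedge_def)
    then show ?thesis
      by (auto simp: has_edge_def)
  qed
  have "card (wedge x y P X Y - ?A) \<le> 2" if W: "\<not> has_edge ?F (wedge x y P X Y)" for X Y
  proof (cases "b \<in> wedge x y P X Y \<or> c \<in> wedge x y P X Y")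
    case False
    then have "wedge x y P X Y - ?A = wedge x y P X Y - A"
      by auto
    moreover have "\<not> has_edge F (wedge x y P X Y)"
      using W by (auto simp: has_edge_def)
    ultimately show ?thesis
      using st by (auto simp: sweep_state_def)
  next
    case True
    have a: "Y \<le> y a"
    proof (rule ccontr)
      assume "\<not> ?thesis"
      with True x y A have "{a, b} \<subseteq> wedge x y P X Y"
        by (auto simp: wedge_def)
      with W show False
        by (auto simp: has_edge_def)
    qed
    have e: "X \<le> x e"
    proof (rule ccontr)
      assume "\<not> ?thesis"
      with True x y A have "{c, e} \<subseteq> wedge x y P X Y"
        by (auto simp: wedge_def)
      with W show False
        by (auto simp: has_edge_def)
    qed
    have "d \<in> {b, c}" if d: "d \<in> wedge x y P X Y - ?A" for d
    proof (rule ccontr)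
      assume nd: "d \<notin> {b, c}"
      obtain s where s: "minimal_in x y P s" "s = d \<or> below x y s d"
        using d ex_minimal_in[of d P x y] by (auto simp: wedge_def)
      have sW: "s \<in> wedge x y P X Y"
        using s d by (auto simp: minimal_in_def wedge_def below_def)
      have "y s < y a"
        using sW a by (auto simp: wedge_def)
      then have "\<not> x s < x a" "s \<noteq> a"
        using min(1) s(1) by (auto simp: minimal_in_def below_def)
      moreover from this have "x s \<noteq> x a"
        using inj(1) s(1) A by (auto simp: minimal_in_def inj_on_def)
      ultimately have "x a < x s"
        by simp
      then have "s = b \<or> s = c"
        using consecutive[OF s(1)] e sW by (auto simp: wedge_def)
      then have "has_edge ?F (wedge x y P (Suc (x d)) (Suc (y d)))"
        using s(2) nd d A edge[of d s] by (auto simp: wedge_def)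
      then show False
        using W d wedge_below_subset[of d x y P X Y] has_edge_mono by blast
    qed
    then have "wedge x y P X Y - ?A \<subseteq> {b, c}"
      by blast
    then have "card (wedge x y P X Y - ?A) \<le> card {b, c}"
      by (intro card_mono) auto
    then show ?thesis
      using neq by simp
  qed
  then show ?thesis
    using st A free edge by (auto simp: sweep_state_def)
qed

text \<open>The \<open>K\<close> staircase points in \<open>W\<close> form \<open>K - 3\<close>
  quadruples of consecutive points. Only the at most two non-free points of \<open>W\<close> can
  spoil a quadruple, and 12 points leave more quadruples than they can spoil.\<close>

lemma ex_quad:
  assumes st: "sweep_state x y P F A" and fin: "finite P"
    and inj: "inj_on x P" "inj_on y P"
    and W_def: "W = wedge x y P X Y" and edgeless: "\<not> has_edge F W" and large: "card W \<ge> 12"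
  obtains a b c e where "a \<in> A \<inter> P" "b \<in> A \<inter> P" "c \<in> A \<inter> P" "e \<in> A \<inter> P"
    and "x a < x b" "x b < x c" "x c < x e"
    and "\<And>s. minimal_in x y P s \<Longrightarrow> x a < x s \<Longrightarrow> x s < x e \<Longrightarrow> s = b \<or> s = c"
    and "\<And>u. u \<in> P \<Longrightarrow> below x y b u \<or> below x y c u \<Longrightarrow> below x y a u \<or> below x y e u"
proof -
  define I where "I = {s \<in> W. minimal_in x y P s}"
  define N where "N = W - A"
  have WP: "W \<subseteq> P"
    by (auto simp: W_def wedge_def)
  have finW: "finite W" "finite I" "finite N"
    using fin WP by (auto simp: I_def N_def intro: finite_subset)
  have N2: "card N \<le> 2"
    using st edgeless by (auto simp: sweep_state_def N_def W_def)
  have WI: "W - I = N - I"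
    using st WP by (auto simp: sweep_state_def N_def I_def)
  obtain h where h: "bij_betw h {..<card (x ` I)} (x ` I)" "strict_mono_on {..<card (x ` I)} h"
    using ex_bij_betw_strict_mono_card[of "x ` I"] finW by blast
  define K where "K = card I"
  have injI: "inj_on x I"
    using inj(1) WP by (auto simp: I_def intro: inj_on_subset)
  have KI: "card (x ` I) = K"
    using injI by (simp add: K_def card_image)
  define s where "s i = inv_into I x (h i)" for i
  have xs: "x (s i) = h i" and sI: "s i \<in> I" if "i < K" for i
  proof -
    have "h i \<in> x ` I"
      using h(1) that KI by (auto simp: bij_betw_def)
    then show "x (s i) = h i" "s i \<in> I"
      by (auto simp: s_def f_inv_into_f inv_into_into)
  qed
  have s_less: "x (s i) < x (s j)" if "i < j" "j < K" for i j
    using that h(2) KI xs by (auto simp: strict_mono_on_def)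
  have s_surj: "\<exists>i<K. s i = p" if p: "p \<in> I" for p
  proof -
    obtain i where "i < K" "h i = x p"
      using h(1) p KI by (metis bij_betw_def imageE imageI lessThan_iff)
    then show ?thesis
      using p injI by (auto simp: s_def)
  qed
  have s_min: "minimal_in x y P (s i)" and sW: "s i \<in> W" if "i < K" for i
    using sI[OF that] by (auto simp: I_def)
  have s_y: "y (s j) < y (s i)" if "i < j" "j < K" for i j
    by (rule staircase_order[OF s_min s_min inj(2) s_less]) (use that in auto)
  have s_inj: "i = j" if "s i = s j" "i < K" "j < K" for i j
    using that s_less by (metis linorder_neqE_nat less_irrefl)

  text \<open>The point \<open>d\<close>, which is not free, can rule out the quadruple starting at \<open>s i\<close> in two ways.
    A point on the staircase rules out at most 4 of the \<open>K - 3\<close> quadruples, a point above the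
    staircase at most 2, because the \<open>s j\<close> below it are consecutive.\<close>
  define blocks where "blocks d i \<longleftrightarrow>
    (if d \<in> I then d \<in> {s i, s (i+1), s (i+2), s (i+3)}
     else (below x y (s (i+1)) d \<or> below x y (s (i+2)) d) \<and>
          \<not> below x y (s i) d \<and> \<not> below x y (s (i+3)) d)" for d i
  have on: "card {i. i < K - 3 \<and> blocks d i} \<le> 4" if d: "d \<in> I" for d
  proof -
    obtain j where j: "j < K" "s j = d"
      using s_surj d by blast
    have "i \<in> {j-3..j}" if i: "i < K - 3" "blocks d i" for i
    proof -
      have "s j = s i \<or> s j = s (i+1) \<or> s j = s (i+2) \<or> s j = s (i+3)"
        using i d j by (auto simp: blocks_def)
      then have "j = i \<or> j = i+1 \<or> j = i+2 \<or> j = i+3"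
        using s_inj[OF _ j(1)] i(1) by (elim disjE) (force simp: less_diff_conv)+
      then show ?thesis by auto
    qed
    then have "{i. i < K - 3 \<and> blocks d i} \<subseteq> {j-3..j}"
      by blast
    then have "card {i. i < K - 3 \<and> blocks d i} \<le> card {j-3..j}"
      by (intro card_mono) auto
    then show ?thesis by simp
  qed
  have off: "card {i. i < K - 3 \<and> blocks d i} \<le> 2" if d: "d \<notin> I" for d
  proof -
    \<comment> \<open>Here \<open>s j\<close> is the leftmost staircase point below
      \<open>d\<close>. A blocked \<open>i\<close> satisfies \<open>j \<le> i + 2\<close>, and
      \<open>j < i\<close> is impossible: \<open>s i\<close> would get its \<open>y\<close>-bound
      from \<open>s j\<close> and its \<open>x\<close>-bound from \<open>s (i+1)\<close> or
      \<open>s (i+2)\<close>, hence lie below \<open>d\<close>.\<close>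
    define j where "j = (LEAST j. j < K \<and> below x y (s j) d)"
    have "i \<in> {j-2..<j}" if i: "i < K - 3" "blocks d i" for i
    proof -
      have bd: "below x y (s (i+1)) d \<or> below x y (s (i+2)) d" "\<not> below x y (s i) d"
        using i d by (auto simp: blocks_def)
      obtain l where l: "l \<le> i + 2" "l < K \<and> below x y (s l) d"
        using bd(1) i(1) that[of "i+1"] that[of "i+2"] by auto
      have j: "j < K \<and> below x y (s j) d"
        unfolding j_def by (rule LeastI) (rule l(2))
      have "j \<le> l"
        unfolding j_def by (rule Least_le) (rule l(2))
      then have "j \<le> i + 2"
        using l(1) by simp
      moreover have "\<not> j < i"
      proof
        assume ji: "j < i"
        have "x (s i) < x (s (i+1))" "x (s i) < x (s (i+2))"
          using i(1) by (auto intro!: s_less)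
        then have "x (s i) < x d"
          using bd(1) by (auto simp: below_def)
        moreover have "y (s i) < y d"
        proof -
          have "i < K"
            using i(1) by simp
          then show ?thesis
            using j s_y[of j i] ji by (auto simp: below_def)
        qed
        ultimately show False
          using bd(2) by (auto simp: below_def)
      qed
      moreover have "j \<noteq> i"
        using bd(2) j by auto
      ultimately show ?thesis by auto
    qed
    then have "{i. i < K - 3 \<and> blocks d i} \<subseteq> {j-2..<j}"
      by blast
    then have "card {i. i < K - 3 \<and> blocks d i} \<le> card {j-2..<j}"
      by (intro card_mono) auto
    then show ?thesis by simp
  qed
  have "\<exists>i<K-3. \<forall>d\<in>N. \<not> blocks d i"
  proof (rule ccontr)
    assume "\<not> ?thesis"
    then have "{..<K-3} \<subseteq> (\<Union>d\<in>N \<inter> I. {i. i < K - 3 \<and> blocks d i}) \<union>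
                           (\<Union>d\<in>N - I. {i. i < K - 3 \<and> blocks d i})"
      by blast
    then have "card {..<K-3} \<le> card ((\<Union>d\<in>N \<inter> I. {i. i < K - 3 \<and> blocks d i}) \<union>
                           (\<Union>d\<in>N - I. {i. i < K - 3 \<and> blocks d i}))"
      by (intro card_mono) (use finW in auto)
    also have "\<dots> \<le> card (\<Union>d\<in>N \<inter> I. {i. i < K - 3 \<and> blocks d i}) +
                    card (\<Union>d\<in>N - I. {i. i < K - 3 \<and> blocks d i})"
      by (rule card_Un_le)
    also have "card (\<Union>d\<in>N \<inter> I. {i. i < K - 3 \<and> blocks d i}) \<le>
               (\<Sum>d\<in>N \<inter> I. card {i. i < K - 3 \<and> blocks d i})"
      using finW by (intro card_UN_le) auto
    also have "\<dots> \<le> (\<Sum>d\<in>N \<inter> I. 4)"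
      using on by (intro sum_mono) auto
    also have "card (\<Union>d\<in>N - I. {i. i < K - 3 \<and> blocks d i}) \<le>
               (\<Sum>d\<in>N - I. card {i. i < K - 3 \<and> blocks d i})"
      using finW by (intro card_UN_le) auto
    also have "\<dots> \<le> (\<Sum>d\<in>N - I. 2)"
      using off by (intro sum_mono) auto
    finally have "K - 3 \<le> card (N \<inter> I) * 4 + card (N - I) * 2"
      by simp
    moreover have "card N = card (N \<inter> I) + card (N - I)"
      using finW card_Int_Diff[of N I] by simp
    moreover have "card W = K + card (N - I)"
    proof -
      have "card W = card (W \<inter> I) + card (W - I)"
        using finW card_Int_Diff[of W I] by simp
      moreover have "W \<inter> I = I"
        by (auto simp: I_def)
      ultimately show ?thesis
        by (simp add: WI K_def)
    qed
    \<comment> \<open>Let p and q be the numbers of non-free points on and off the staircase. Then K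
      + q >= 12 and K - 3 <= 4p + 2q give 9 <= 4p + 3q, whereas p + q <= 2 gives 4p + 3q <=
      8.\<close>
    ultimately show False
      using N2 large by linarith
  qed
  then obtain i where i: "i < K - 3" and nb: "\<And>d. d \<in> N \<Longrightarrow> \<not> blocks d i"
    by blast
  have iK: "i < K" "i + 1 < K" "i + 2 < K" "i + 3 < K"
    using i by auto
  have inA: "s j \<in> A \<inter> P" if "j \<in> {i, i+1, i+2, i+3}" for j
  proof -
    have "j < K"
      using that iK by auto
    moreover have "s j \<notin> N"
      using nb[of "s j"] sI[OF \<open>j < K\<close>] that by (auto simp: blocks_def)
    ultimately show ?thesis
      using sW WP by (auto simp: N_def)
  qed
  have s01: "x (s i) < x (s (i+1))" "y (s (i+1)) < y (s i)"
    and s12: "x (s (i+1)) < x (s (i+2))" "y (s (i+2)) < y (s (i+1))"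
    and s23: "x (s (i+2)) < x (s (i+3))" "y (s (i+3)) < y (s (i+2))"
    using iK by (auto intro: s_less s_y)
  show ?thesis
  proof (rule that[of "s i" "s (i+1)" "s (i+2)" "s (i+3)"])
    fix t assume t: "minimal_in x y P t" "x (s i) < x t" "x t < x (s (i+3))"
    have "y t < y (s i)"
      by (rule staircase_order[OF s_min[OF iK(1)] t(1) inj(2) t(2)])
    then have "t \<in> I"
      using t sW[OF iK(1)] sW[OF iK(4)] by (auto simp: I_def W_def wedge_def minimal_in_def)
    then obtain j where j: "j < K" "s j = t"
      using s_surj by blast
    have "\<not> j \<le> i"
      using t(2) j s_less[of j i] iK by (auto simp: le_less)
    moreover have "\<not> i + 3 \<le> j"
      using t(3) j s_less[of "i+3" j] iK by (auto simp: le_less)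
    ultimately have "j = i + 1 \<or> j = i + 2"
      by auto
    then show "t = s (i+1) \<or> t = s (i+2)"
      using j by auto
  next
    fix u assume u: "u \<in> P" "below x y (s (i+1)) u \<or> below x y (s (i+2)) u"
    show "below x y (s i) u \<or> below x y (s (i+3)) u"
    proof (rule ccontr)
      assume neg: "\<not> ?thesis"
      \<comment> \<open>The point \<open>u\<close> must lie in \<open>W\<close>: beyond
        \<open>X\<close> it would be above \<open>s (i+3)\<close>, and beyond \<open>Y\<close> above
        \<open>s i\<close>. Not being minimal, it is not free, and so it would block
        \<open>i\<close>.\<close>
      have "\<not> X \<le> x u"
      proof
        assume "X \<le> x u"
        then have "x (s (i+3)) < x u"
          using sW[OF iK(4)] by (auto simp: W_def wedge_def)
        moreover have "y (s (i+3)) < y u"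
          using u(2) s12 s23 by (auto simp: below_def)
        ultimately show False
          using neg by (auto simp: below_def)
      qed
      moreover have "\<not> Y \<le> y u"
      proof
        assume "Y \<le> y u"
        then have "y (s i) < y u"
          using sW[OF iK(1)] by (auto simp: W_def wedge_def)
        moreover have "x (s i) < x u"
          using u(2) s01 s12 by (auto simp: below_def)
        ultimately show False
          using neg by (auto simp: below_def)
      qed
      ultimately have "u \<in> W"
        using u by (auto simp: W_def wedge_def)
      moreover have "\<not> minimal_in x y P u"
        using u inA by (auto simp: minimal_in_def)
      ultimately have "u \<in> N" "u \<notin> I"
        using st WP by (auto simp: N_def I_def sweep_state_def)
      then show False
        using nb[of u] u(2) neg by (auto simp: blocks_def)
    qed
  qed (use inA s01 s12 s23 in auto)
qed

text \<open>Each edgeless wedge with 12 points yields a quadruple, and using it costs two free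
  points of \<open>P\<close>, so the process stops.\<close>

lemma sweep_state_saturate:
  assumes "sweep_state x y P F A" "finite P" "inj_on x P" "inj_on y P"
  shows "\<exists>F' A'. sweep_state x y P F' A' \<and> F \<subseteq> F' \<and>
           (\<forall>X Y. card (wedge x y P X Y) \<ge> 12 \<longrightarrow> has_edge F' (wedge x y P X Y))"
  using assms(1)
proof (induction "card (A \<inter> P)" arbitrary: F A rule: less_induct)
  case less
  show ?case
  proof (cases "\<forall>X Y. card (wedge x y P X Y) \<ge> 12 \<longrightarrow> has_edge F (wedge x y P X Y)")
    case False
    then obtain X Y where XY: "card (wedge x y P X Y) \<ge> 12" "\<not> has_edge F (wedge x y P X Y)"
      by blast
    obtain a b c e where q: "a \<in> A \<inter> P" "b \<in> A \<inter> P" "c \<in> A \<inter> P" "e \<in> A \<inter> P"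
      "x a < x b" "x b < x c" "x c < x e"
      "\<And>s. minimal_in x y P s \<Longrightarrow> x a < x s \<Longrightarrow> x s < x e \<Longrightarrow> s = b \<or> s = c"
      "\<And>u. u \<in> P \<Longrightarrow> below x y b u \<or> below x y c u \<Longrightarrow> below x y a u \<or> below x y e u"
      using ex_quad[OF less.prems assms(2-4) refl XY(2,1)] by blast
    have "(A - {b, c}) \<inter> P \<subset> A \<inter> P"
      using q by auto
    then have "card ((A - {b, c}) \<inter> P) < card (A \<inter> P)"
      using assms(2) by (intro psubset_card_mono) auto
    from less.hyps[OF this sweep_state_quad[OF less.prems assms(3,4) q]] show ?thesis
      by blast
  qed (use less.prems in blast)
qed

text \<open>The points joined to \<open>p\<close> lose their freedom, since they must avoid the
  color of \<open>p\<close>; \<open>p\<close> itself is free and, by \<open>new\<close>,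
  minimal.\<close>

lemma sweep_state_insert:
  assumes st: "sweep_state x y P F A" and p: "p \<notin> P" and new: "\<And>q. q \<in> P \<Longrightarrow> \<not> below x y q p"
    and fin: "finite P"
  shows "sweep_state x y (insert p P) (F \<union> {(a, p) |a. a \<in> A \<inter> P \<and> below x y p a})
           (A - {a \<in> P. below x y p a})"
proof -
  let ?F = "F \<union> {(a, p) |a. a \<in> A \<inter> P \<and> below x y p a}" and ?A = "A - {a \<in> P. below x y p a}"
  let ?P = "insert p P"
  have pA: "p \<in> A"
    using st p by (auto simp: sweep_state_def)
  have "\<exists>col. (\<forall>(u, v)\<in>?F. col u \<noteq> col v) \<and> (\<forall>v\<in>?A. col v = g v)" for g :: "'a \<Rightarrow> bool"
  proof -
    define g' where "g' a = (if a \<in> P \<and> below x y p a then \<not> g p else g a)" for a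
    have "freely_colorable F A"
      using st by (simp add: sweep_state_def)
    then obtain col where F: "\<forall>(u, v)\<in>F. col u \<noteq> col v" and col: "\<forall>v\<in>A. col v = g' v"
      by (rule freely_colorableE)
    have "col p = g p"
      using col pA p by (simp add: g'_def)
    then have "\<forall>(u, v)\<in>?F. col u \<noteq> col v"
      using F col by (auto simp: g'_def)
    moreover have "\<forall>v\<in>?A. col v = g v"
      using col by (auto simp: g'_def)
    ultimately show ?thesis
      by blast
  qed
  then have free: "freely_colorable ?F ?A"
    by (simp add: freely_colorable_def)
  have edge: "has_edge ?F (wedge x y ?P (Suc (x u)) (Suc (y u)))"
    if u: "u \<in> ?P" and d: "d \<in> ?P - ?A" and du: "below x y d u" for d u
  proof -
    have dP: "d \<in> P"
      using d pA p by auto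
    then have uP: "u \<in> P"
      using u du new by auto
    show ?thesis
    proof (cases "d \<in> A")
      case True
      then have "below x y p d"
        using d dP by auto
      then show ?thesis
        unfolding has_edge_def wedge_def
        using True dP du by (intro bexI[of _ "(d, p)"]) (auto simp: below_def)
    next
      case False
      then have "has_edge F (wedge x y P (Suc (x u)) (Suc (y u)))"
        using st uP dP du by (auto simp: sweep_state_def)
      then show ?thesis
        by (rule has_edge_mono) (auto simp: wedge_def)
    qed
  qed
  have "card (wedge x y ?P X Y - ?A) \<le> 2" if W: "\<not> has_edge ?F (wedge x y ?P X Y)" for X Y
  proof -
    \<comment> \<open>A wedge containing a point just joined to \<open>p\<close> also contains
      \<open>p\<close>, hence an edge. So an edgeless wedge acquires no non-free points.\<close>
    have "wedge x y ?P X Y - ?A \<subseteq> wedge x y P X Y - A"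
    proof
      fix d assume d: "d \<in> wedge x y ?P X Y - ?A"
      then have dP: "d \<in> P"
        using pA p by (auto simp: wedge_def)
      have "d \<notin> A"
      proof
        assume "d \<in> A"
        then have "has_edge ?F (wedge x y ?P X Y)"
          unfolding has_edge_def wedge_def
          using d dP by (intro bexI[of _ "(d, p)"]) (auto simp: below_def wedge_def)
        with W show False ..
      qed
      with d dP show "d \<in> wedge x y P X Y - A"
        by (auto simp: wedge_def)
    qed
    moreover have "finite (wedge x y P X Y)"
      using fin by (simp add: wedge_def)
    ultimately have "card (wedge x y ?P X Y - ?A) \<le> card (wedge x y P X Y - A)"
      by (intro card_mono) auto
    also have "\<not> has_edge F (wedge x y P X Y)"
    proof
      assume "has_edge F (wedge x y P X Y)"
      then have "has_edge ?F (wedge x y ?P X Y)"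
        by (rule has_edge_mono) (auto simp: wedge_def)
      with W show False ..
    qed
    then have "card (wedge x y P X Y - A) \<le> 2"
      using st by (auto simp: sweep_state_def)
    finally show ?thesis .
  qed
  moreover have "minimal_in x y ?P a" if "a \<in> ?A \<inter> ?P" for a
    using that st new p by (auto simp: sweep_state_def minimal_in_def below_def)
  moreover have "- ?P \<subseteq> ?A"
    using st by (auto simp: sweep_state_def)
  ultimately show ?thesis
    using free edge unfolding sweep_state_def by blast
qed

section \<open>The sweep along the third order\<close>

definition octant_part ::
    "('a \<Rightarrow> nat) \<Rightarrow> ('a \<Rightarrow> nat) \<Rightarrow> ('a \<Rightarrow> nat) \<Rightarrow> 'a set \<Rightarrow> nat \<Rightarrow> nat \<Rightarrow> nat \<Rightarrow> 'a set" where
  "octant_part x y z P X Y Z = {p \<in> P. x p < X \<and> y p < Y \<and> z p < Z}"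

text \<open>An antichain in the product of three orders, without ties in any coordinate.\<close>

definition independent3 ::
    "('a \<Rightarrow> nat) \<Rightarrow> ('a \<Rightarrow> nat) \<Rightarrow> ('a \<Rightarrow> nat) \<Rightarrow> 'a set \<Rightarrow> bool" where
  "independent3 x y z P \<longleftrightarrow>
     inj_on x P \<and> inj_on y P \<and> inj_on z P \<and> (\<forall>p\<in>P. \<forall>q\<in>P. \<not> (below x y p q \<and> z p < z q))"

lemma independent3_subset: "independent3 x y z P \<Longrightarrow> Q \<subseteq> P \<Longrightarrow> independent3 x y z Q"
  by (auto simp: independent3_def intro: inj_on_subset)

text \<open>The third coordinate serves as time. The octant parts with \<open>Z = s\<close> are
  exactly the wedges among the points inserted by time \<open>s\<close>; they receive their edges
  when that stage is saturated, and edges are never removed.\<close>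

lemma ex_sweep_state:
  assumes fin: "finite P" and ind: "independent3 x y z P"
  shows "\<exists>F A. sweep_state x y {p\<in>P. z p < t} F A \<and>
           (\<forall>s\<le>t. \<forall>X Y. card (octant_part x y z P X Y s) \<ge> 12 \<longrightarrow>
              has_edge F (octant_part x y z P X Y s))"
proof (induction t)
  case 0
  have "sweep_state x y {p\<in>P. z p < 0} {} UNIV"
    by (auto simp: sweep_state_def freely_colorable_def)
  then show ?case
    by (force simp: octant_part_def)
next
  case (Suc t)
  let ?P = "{p\<in>P. z p < t}" and ?Q = "{p\<in>P. z p < Suc t}"
  obtain F A where st: "sweep_state x y ?P F A"
    and old: "\<And>s X Y. s \<le> t \<Longrightarrow> card (octant_part x y z P X Y s) \<ge> 12 \<Longrightarrow>
                has_edge F (octant_part x y z P X Y s)"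
    using Suc.IH by blast
  have "\<exists>F' A'. sweep_state x y ?Q F' A' \<and> F \<subseteq> F'"
  proof (cases "\<exists>p\<in>P. z p = t")
    case True
    then obtain p where p: "p \<in> P" "z p = t"
      by blast
    have Q: "?Q = insert p ?P"
    proof -
      have uniq: "q = p" if "q \<in> P" "z q = t" for q
        using that p ind by (auto simp: independent3_def inj_on_def)
      show ?thesis
        using p by (auto simp: less_Suc_eq dest: uniq)
    qed
    have "sweep_state x y (insert p ?P) (F \<union> {(a, p) |a. a \<in> A \<inter> ?P \<and> below x y p a})
           (A - {a \<in> ?P. below x y p a})"
      by (rule sweep_state_insert[OF st]) (use p ind fin in \<open>auto simp: independent3_def\<close>)
    then show ?thesis
      unfolding Q by blast
  next
    case False
    then have "?Q = ?P"
      by (auto simp: less_Suc_eq)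
    with st show ?thesis
      by auto
  qed
  then obtain F1 A1 where st1: "sweep_state x y ?Q F1 A1" and "F \<subseteq> F1"
    by blast
  have "inj_on x ?Q" "inj_on y ?Q" "finite ?Q"
    using fin ind by (auto simp: independent3_def intro: inj_on_subset)
  then obtain F2 A2 where st2: "sweep_state x y ?Q F2 A2" and "F1 \<subseteq> F2"
    and sat: "\<And>X Y. card (wedge x y ?Q X Y) \<ge> 12 \<Longrightarrow> has_edge F2 (wedge x y ?Q X Y)"
    using sweep_state_saturate[OF st1] by blast
  have "has_edge F2 (octant_part x y z P X Y s)"
    if "s \<le> Suc t" "card (octant_part x y z P X Y s) \<ge> 12" for s X Y
  proof (cases "s = Suc t")
    case True
    have "octant_part x y z P X Y s = wedge x y ?Q X Y"
      using True by (auto simp: octant_part_def wedge_def)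
    then show ?thesis
      using sat that by simp
  next
    case False
    then have "has_edge F (octant_part x y z P X Y s)"
      using that old by simp
    then show ?thesis
      by (rule has_edge_mono) (use \<open>F \<subseteq> F1\<close> \<open>F1 \<subseteq> F2\<close> in auto)
  qed
  with st2 show ?case
    by blast
qed

lemma two_coloring_independent3:
  assumes "finite P" "independent3 x y z P"
  shows "\<exists>col :: 'a \<Rightarrow> bool. \<forall>X Y Z. card (octant_part x y z P X Y Z) \<ge> 12 \<longrightarrow>
           (\<forall>b. \<exists>p\<in>octant_part x y z P X Y Z. col p = b)"
proof -
  \<comment> \<open>At this time all points are inserted, so larger values of \<open>Z\<close> can
    be cut down to \<open>t\<close>.\<close>
  define t where "t = Suc (Max (z ` P))"
  obtain F A where st: "sweep_state x y {p\<in>P. z p < t} F A"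
    and F: "\<And>s X Y. s \<le> t \<Longrightarrow> card (octant_part x y z P X Y s) \<ge> 12 \<Longrightarrow>
              has_edge F (octant_part x y z P X Y s)"
    using ex_sweep_state[OF assms, of t] by blast
  obtain col :: "'a \<Rightarrow> bool" where col: "\<forall>(u, v)\<in>F. col u \<noteq> col v"
  proof -
    have "freely_colorable F A"
      using st by (simp add: sweep_state_def)
    then show ?thesis
      by (rule freely_colorableE[where g = "\<lambda>_. True"]) (rule that)
  qed
  have "\<exists>p\<in>octant_part x y z P X Y Z. col p = b"
    if "card (octant_part x y z P X Y Z) \<ge> 12" for X Y Z b
  proof -
    have "z p < t" if "p \<in> P" for p
      using that assms(1) by (simp add: t_def less_Suc_eq_le)
    then have eq: "octant_part x y z P X Y Z = octant_part x y z P X Y (min Z t)"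
      by (auto simp: octant_part_def)
    then have "has_edge F (octant_part x y z P X Y Z)"
      using F[of "min Z t" X Y] that by simp
    then obtain u v where "(u, v) \<in> F" "u \<in> octant_part x y z P X Y Z" "v \<in> octant_part x y z P X Y Z"
      by (auto simp: has_edge_def)
    moreover have "col u \<noteq> col v"
      using col \<open>(u, v) \<in> F\<close> by auto
    ultimately show ?thesis
      by (cases "col u = b") auto
  qed
  then show ?thesis
    by (intro exI[of _ col] allI impI)
qed

section \<open>More colors\<close>

text \<open>If color \<open>b\<close> occurs fewer than n times, these occurrences sort the
  remaining points into at most n^2 cells. A cell of 12 points would span an octant containing color
  \<open>b\<close>, which the antichain property rules out. The total is then less than n + 11 n^2
  <= 12 n^2.\<close>

lemma color_class_large:
  fixes col :: "'a \<Rightarrow> bool"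
  assumes fin: "finite P" and ind: "independent3 x y z P"
    and col: "\<And>X Y Z b. card (octant_part x y z P X Y Z) \<ge> 12 \<Longrightarrow>
                \<exists>p\<in>octant_part x y z P X Y Z. col p = b"
    and large: "card (octant_part x y z P X Y Z) \<ge> 12 * n\<^sup>2"
  shows "card {p \<in> octant_part x y z P X Y Z. col p = b} \<ge> n"
proof (rule ccontr)
  let ?O = "octant_part x y z P X Y Z"
  define B where "B = {p \<in> ?O. col p = b}"
  assume "\<not> ?thesis"
  then have Bn: "card B < n"
    by (simp add: B_def)
  have finO: "finite ?O" "finite B"
    using fin by (auto simp: octant_part_def B_def)
  \<comment> \<open>The sets \<open>Bz r\<close> form a chain, and so do the sets
    \<open>Bzx r\<close> for a fixed \<open>Bz r\<close>. Two cardinalities therefore determine both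
    sets.\<close>
  define Bz where "Bz r = {q\<in>B. z q < z r}" for r
  define Bzx where "Bzx r = {q\<in>Bz r. x q < x r}" for r
  define cell where "cell r = (card (Bz r), card (Bzx r))" for r
  have finBz: "finite (Bz r)" "finite (Bzx r)" for r
    using finO by (simp_all add: Bz_def Bzx_def)
  have fibre: "card {r \<in> ?O - B. cell r = ij} \<le> 11" for ij
  proof (cases "{r \<in> ?O - B. cell r = ij} = {}")
    case True
    then show ?thesis by (simp only: card.empty)
  next
    case False
    define G where "G = {r \<in> ?O - B. cell r = ij}"
    have G: "finite G" "G \<noteq> {}"
      using finO False by (auto simp: G_def)
    have GO: "r \<in> P" "x r < X" "y r < Y" "z r < Z" "r \<notin> B" if "r \<in> G" for r
      using that by (auto simp: G_def octant_part_def)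
    have same_z: "Bz r = Bz r'" if "r \<in> G" "r' \<in> G" for r r'
    proof -
      have "card (Bz r) = card (Bz r')"
        using that by (auto simp: G_def cell_def)
      moreover have "Bz r \<subseteq> Bz r' \<or> Bz r' \<subseteq> Bz r"
        by (cases "z r \<le> z r'") (auto simp: Bz_def)
      ultimately show ?thesis
        using finBz card_subset_eq by metis
    qed
    have same_zx: "Bzx r = Bzx r'" if "r \<in> G" "r' \<in> G" for r r'
    proof -
      have "card (Bzx r) = card (Bzx r')"
        using that by (auto simp: G_def cell_def)
      moreover have "Bzx r \<subseteq> Bzx r' \<or> Bzx r' \<subseteq> Bzx r"
        using same_z[OF that] by (cases "x r \<le> x r'") (auto simp: Bzx_def)
      ultimately show ?thesis
        using finBz card_subset_eq by metis
    qed
    \<comment> \<open>The smallest octant part containing \<open>G\<close>. It lies inside the given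
      one, so its points of color \<open>b\<close> belong to \<open>B\<close>.\<close>
    define O' where
      "O' = octant_part x y z P (Suc (Max (x ` G))) (Suc (Max (y ` G))) (Suc (Max (z ` G)))"
    have "G \<subseteq> O'"
      using G GO by (auto simp: O'_def octant_part_def less_Suc_eq_le)
    moreover have "finite O'"
      using fin by (simp add: O'_def octant_part_def)
    ultimately have "card G \<le> card O'"
      by (intro card_mono)
    moreover have "card O' < 12"
    proof (rule ccontr)
      assume "\<not> card O' < 12"
      then obtain q where q: "q \<in> O'" "col q = b"
        using col[of "Suc (Max (x ` G))" "Suc (Max (y ` G))" "Suc (Max (z ` G))" b]
        by (auto simp: O'_def)
      have ex_max: "\<exists>r\<in>G. f r = Max (f ` G)" for f :: "'a \<Rightarrow> nat"
      proof -
        have "Max (f ` G) \<in> f ` G"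
          using G by (intro Max_in) auto
        then obtain r where "Max (f ` G) = f r" "r \<in> G"
          by (rule imageE)
        then show ?thesis
          by (intro bexI[of _ r]) simp_all
      qed
      obtain rx where rx: "rx \<in> G" "x rx = Max (x ` G)"
        using ex_max[of x] by blast
      obtain ry where ry: "ry \<in> G" "y ry = Max (y ` G)"
        using ex_max[of y] by blast
      obtain rz where rz: "rz \<in> G" "z rz = Max (z ` G)"
        using ex_max[of z] by blast
      have qP: "q \<in> P" and le: "x q \<le> x rx" "y q \<le> y ry" "z q \<le> z rz"
        using q rx ry rz by (auto simp: O'_def octant_part_def)
      have qB: "q \<in> B"
        using le qP q GO[OF rx(1)] GO[OF ry(1)] GO[OF rz(1)]
        by (auto simp: B_def octant_part_def)
      have neq: "q \<noteq> r" if "r \<in> G" for r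
        using qB GO[OF that] by auto
      \<comment> \<open>Equality of cells moves each comparison to another point of
        \<open>G\<close>: \<open>q\<close> precedes \<open>rz\<close> in \<open>z\<close>, hence
        also \<open>rx\<close>; it precedes \<open>rx\<close> in \<open>x\<close>, hence lies in
        \<open>Bzx ry\<close>; and it precedes \<open>ry\<close> in \<open>y\<close>. So
        \<open>q\<close> is below \<open>ry\<close> in all three orders.\<close>
      have "z q < z rz"
        using le neq[OF rz(1)] GO[OF rz(1)] qP ind
        by (auto simp: independent3_def inj_on_def le_less)
      then have "q \<in> Bz rx"
        using same_z[OF rz(1) rx(1)] qB by (auto simp: Bz_def)
      moreover have "x q < x rx"
        using le neq[OF rx(1)] GO[OF rx(1)] qP ind
        by (auto simp: independent3_def inj_on_def le_less)
      ultimately have "q \<in> Bzx ry"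
        using same_zx[OF rx(1) ry(1)] by (auto simp: Bzx_def)
      moreover have "y q < y ry"
        using le neq[OF ry(1)] GO[OF ry(1)] qP ind
        by (auto simp: independent3_def inj_on_def le_less)
      ultimately show False
        using ind qP GO[OF ry(1)] by (auto simp: independent3_def below_def Bzx_def Bz_def)
    qed
    ultimately show ?thesis
      by (simp add: G_def)
  qed
  define T where "T = {..<n} \<times> {..<n}"
  have "cell r \<in> T" for r
  proof -
    have "card (Bz r) \<le> card B" "card (Bzx r) \<le> card B"
      using finO by (auto intro!: card_mono simp: Bz_def Bzx_def)
    then show ?thesis
      using Bn by (simp add: cell_def T_def)
  qed
  then have cover: "?O - B = (\<Union>ij\<in>T. {r \<in> ?O - B. cell r = ij})"
    by auto
  have "card (\<Union>ij\<in>T. {r \<in> ?O - B. cell r = ij}) \<le> (\<Sum>ij\<in>T. card {r \<in> ?O - B. cell r = ij})"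
    by (rule card_UN_le) (simp add: T_def)
  also have "\<dots> \<le> (\<Sum>ij\<in>T. 11)"
    using fibre by (intro sum_mono)
  finally have "card (?O - B) \<le> 11 * n\<^sup>2"
    unfolding cover[symmetric] by (simp add: T_def power2_eq_square)
  moreover have "card ?O = card B + card (?O - B)"
  proof -
    have "?O \<inter> B = B"
      by (auto simp: B_def)
    then show ?thesis
      using card_Int_Diff[OF finO(1), of B] by simp
  qed
  moreover have "n \<le> n\<^sup>2"
    by (simp add: power2_eq_square)
  ultimately show False
    using large Bn by linarith
qed

text \<open>One class of the 2-coloring becomes the new color and the other is colored recursively.
  An octant with 12 M^2 points has at least M points in each class; iterating M -> 12 M^2 from 1
  gives the exponents 2^(k-1) - 1.\<close>

lemma polychromatic_independent3:
  assumes "finite K" "K \<noteq> {}" "finite P" "independent3 x y z P"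
  shows "\<exists>c :: 'a \<Rightarrow> 'c. c ` P \<subseteq> K \<and>
           (\<forall>X Y Z. card (octant_part x y z P X Y Z) \<ge> 12 ^ (2 ^ (card K - 1) - 1) \<longrightarrow>
              K \<subseteq> c ` octant_part x y z P X Y Z)"
  using assms
proof (induction K arbitrary: P rule: finite_ne_induct)
  case (singleton \<kappa>)
  show ?case
  proof (intro exI[of _ "\<lambda>_. \<kappa>"] conjI allI impI)
    fix X Y Z
    assume "12 ^ (2 ^ (card {\<kappa>} - 1) - 1) \<le> card (octant_part x y z P X Y Z)"
    then have "octant_part x y z P X Y Z \<noteq> {}"
      by fastforce
    then show "{\<kappa>} \<subseteq> (\<lambda>_. \<kappa>) ` octant_part x y z P X Y Z"
      by blast
  qed blast
next
  case (insert \<kappa> K)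
  define M :: nat where "M = 12 ^ (2 ^ (card K - 1) - 1)"
  obtain col :: "'a \<Rightarrow> bool" where
    col: "\<And>X Y Z b. card (octant_part x y z P X Y Z) \<ge> 12 \<Longrightarrow>
            \<exists>p\<in>octant_part x y z P X Y Z. col p = b"
    using two_coloring_independent3[OF insert.prems] by metis
  define R where "R = {p\<in>P. col p}"
  have "finite R" "independent3 x y z R"
    using insert.prems by (auto simp: R_def intro: independent3_subset)
  then have "\<exists>c :: 'a \<Rightarrow> 'c. c ` R \<subseteq> K \<and>
      (\<forall>X Y Z. card (octant_part x y z R X Y Z) \<ge> M \<longrightarrow> K \<subseteq> c ` octant_part x y z R X Y Z)"
    unfolding M_def by (rule insert.IH)
  then obtain c :: "'a \<Rightarrow> 'c" where c: "c ` R \<subseteq> K"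
    "\<forall>X Y Z. card (octant_part x y z R X Y Z) \<ge> M \<longrightarrow> K \<subseteq> c ` octant_part x y z R X Y Z"
    by (elim exE conjE) (rule that)
  define c' where "c' p = (if col p then c p else \<kappa>)" for p
  have "1 \<le> card K"
    using insert.hyps by (simp add: Suc_leI card_gt_0_iff)
  then have pow: "12 ^ (2 ^ (card (insert \<kappa> K) - 1) - 1) = 12 * M\<^sup>2"
  proof -
    obtain k where k: "card K = Suc k"
      using \<open>1 \<le> card K\<close> by (cases "card K") auto
    have "(2::nat) ^ Suc k - 1 = Suc (2 * (2 ^ k - 1))"
      unfolding power_Suc using one_le_power[of "2::nat" k] by linarith
    then show ?thesis
      using insert.hyps k by (simp add: M_def power_mult[symmetric] mult.commute)
  qed
  have "insert \<kappa> K \<subseteq> c' ` octant_part x y z P X Y Z"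
    if large: "card (octant_part x y z P X Y Z) \<ge> 12 * M\<^sup>2" for X Y Z
  proof -
    have n: "card {p \<in> octant_part x y z P X Y Z. col p = b} \<ge> M" for b
      by (rule color_class_large[OF insert.prems col large])
    have "octant_part x y z R X Y Z = {p \<in> octant_part x y z P X Y Z. col p = True}"
      by (auto simp: octant_part_def R_def)
    then have "K \<subseteq> c ` {p \<in> octant_part x y z P X Y Z. col p = True}"
      using c(2)[rule_format, of X Y Z] n[of True] by simp
    then have "K \<subseteq> c' ` octant_part x y z P X Y Z"
      by (force simp: c'_def)
    moreover have "{p \<in> octant_part x y z P X Y Z. col p = False} \<noteq> {}"
    proof
      assume "{p \<in> octant_part x y z P X Y Z. col p = False} = {}"
      then have "M \<le> 0"
        using n[of False] by (simp only: card.empty)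
      then show False
        by (simp add: M_def)
    qed
    then have "\<kappa> \<in> c' ` octant_part x y z P X Y Z"
      by (force simp: c'_def)
    ultimately show ?thesis
      by simp
  qed
  moreover have "c' ` P \<subseteq> insert \<kappa> K"
    using c(1) by (auto simp: c'_def R_def)
  ultimately show ?case
    using pow by (intro exI[of _ c']) auto
qed

section \<open>Arbitrary point sets\<close>

text \<open>The first summand pays for the minimal points, the second for \<open>Suc k\<close>
  classes that each stay below the threshold for \<open>k\<close> colors.\<close>

fun threshold :: "nat \<Rightarrow> nat" where
  "threshold 0 = 1"
| "threshold (Suc k) = 12 ^ (2 ^ k - 1) + Suc k * (threshold k - 1)"

declare threshold.simps [simp del]

text \<open>Guarantees that a class reaching its threshold is nonempty, also for
  \<open>k = 0\<close>.\<close>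

lemma threshold_pos: "threshold k \<ge> 1"
  by (cases k) (simp_all add: threshold.simps trans_le_add1)

text \<open>For k = j + 2 the exponent is e = 3 * 2^j - 2, with equality of the two sides at j = 0.
  Passing to j + 1 turns e into 2e + 2; both summands of the recursion are at most 12^(2e+1), the
  second because j + 3 <= 12^e.\<close>

lemma threshold_le:
  assumes "k \<ge> 2"
  shows "threshold k \<le> 12 ^ (2 ^ (k - 1) + 2 ^ (k - 2) - 2)"
proof -
  have "threshold (j + 2) \<le> 12 ^ (3 * 2 ^ j - 2)" for j
  proof (induction j)
    case 0
    have "threshold (Suc 0) = 1"
      by (simp add: threshold.simps)
    then have "threshold (Suc (Suc 0)) = 12"
      by (simp add: threshold.simps(2)[of "Suc 0"])
    moreover have "(0::nat) + 2 = Suc (Suc 0)"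
      by simp
    ultimately show ?case by simp
  next
    case (Suc j)
    define e :: nat where "e = 3 * 2 ^ j - 2"
    have j: "(2::nat) ^ j \<ge> 1"
      by simp
    have "j + 3 \<le> 12 ^ e"
    proof -
      have "j + 1 \<le> 2 ^ j"
        using less_exp[of j] by (simp add: Suc_leI)
      then have "j + 1 \<le> e"
        using j unfolding e_def by linarith
      moreover have "e < 2 ^ e"
        by (rule less_exp)
      moreover have "2 * 2 ^ e \<le> (12::nat) ^ e"
      proof -
        have "e \<ge> 1"
          using j unfolding e_def by linarith
        then have "(2::nat) * 2 ^ e \<le> 6 ^ e * 2 ^ e"
          by (intro mult_right_mono order.trans[OF _ self_le_power[of "6::nat" e]]) auto
        also have "\<dots> = 12 ^ e"
          by (simp flip: power_mult_distrib)
        finally show ?thesis .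
      qed
      moreover have "(2::nat) \<le> 2 ^ e"
        using \<open>j + 1 \<le> e\<close> by (intro self_le_power) auto
      ultimately show ?thesis
        by linarith
    qed
    moreover have "threshold (j + 2) - 1 \<le> 12 ^ e"
      using Suc.IH unfolding e_def by linarith
    ultimately have "(j + 3) * (threshold (j + 2) - 1) \<le> 12 ^ e * 12 ^ e"
      by (rule mult_mono) simp_all
    also have "\<dots> = 12 ^ (2 * e)"
      by (simp add: mult_2 power_add)
    also have "(12::nat) ^ (2 * e) \<le> 12 ^ (2 * e + 1)"
      by simp
    finally have "(j + 3) * (threshold (j + 2) - 1) \<le> 12 ^ (2 * e + 1)" .
    moreover have "(12::nat) ^ (2 ^ (j + 2) - 1) \<le> 12 ^ (2 * e + 1)"
    proof (rule power_increasing)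
      have "(2::nat) ^ (j + 2) = 4 * 2 ^ j"
        by (simp add: power_add)
      then show "2 ^ (j + 2) - 1 \<le> 2 * e + 1"
        using j unfolding e_def by linarith
    qed simp
    moreover have "threshold (Suc j + 2) = 12 ^ (2 ^ (j + 2) - 1) + (j + 3) * (threshold (j + 2) - 1)"
    proof -
      have "threshold (Suc (j + 2)) = 12 ^ (2 ^ (j + 2) - 1) + Suc (j + 2) * (threshold (j + 2) - 1)"
        by (rule threshold.simps)
      moreover have "Suc (j + 2) = j + 3" "Suc j + 2 = Suc (j + 2)"
        by simp_all
      ultimately show ?thesis
        by (simp only:)
    qed
    ultimately have "threshold (Suc j + 2) \<le> 12 * 12 ^ (2 * e + 1)"
      by linarith
    also have "\<dots> = 12 ^ (2 * e + 2)"
      by simp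
    also have "2 * e + 2 = 3 * 2 ^ Suc j - 2"
      using j unfolding e_def power_Suc by linarith
    finally show ?case .
  qed
  moreover obtain j where "k = j + 2"
    using assms by (metis add.commute le_Suc_ex)
  moreover have "(2::nat) ^ (j + 1) + 2 ^ j - 2 = 3 * 2 ^ j - 2" for j
    by simp
  ultimately show ?thesis
    by auto
qed

text \<open>An octant with few minimal points reaches the threshold in some class
  \<open>R \<kappa>\<close> by pigeonhole. That class shows all colors except \<kappa>, and the
  minimal points assigned to it supply \<kappa>. The colors form an arbitrary finite set because the
  recursion deletes a different color for each class.\<close>

lemma polychromatic:
  assumes "finite P" "inj_on x P" "inj_on y P" "inj_on z P" "finite K"
  shows "\<exists>c :: 'a \<Rightarrow> 'c. \<forall>X Y Z. card (octant_part x y z P X Y Z) \<ge> threshold (card K) \<longrightarrow>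
           K \<subseteq> c ` octant_part x y z P X Y Z"
  using assms
proof (induction "card K" arbitrary: K P)
  case 0
  then show ?case by auto
next
  case (Suc k)
  define A where "A = {p\<in>P. \<forall>q\<in>P. \<not> (below x y q p \<and> z q < z p)}"
  have "finite A" "independent3 x y z A" "K \<noteq> {}"
  proof -
    have "A \<subseteq> P"
      by (auto simp: A_def)
    then show "finite A" "independent3 x y z A"
      using Suc.prems inj_on_subset[OF _ \<open>A \<subseteq> P\<close>]
      by (auto simp: independent3_def A_def intro: finite_subset)
    show "K \<noteq> {}"
      using Suc.hyps(2) by auto
  qed
  then obtain c0 where c0: "c0 ` A \<subseteq> K"
    "\<And>X Y Z. card (octant_part x y z A X Y Z) \<ge> 12 ^ (2 ^ k - 1) \<Longrightarrow>
       K \<subseteq> c0 ` octant_part x y z A X Y Z"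
    using polychromatic_independent3[OF Suc.prems(5), of A x y z] Suc.hyps(2)
    by (metis diff_Suc_1)
  have "\<exists>a\<in>A. a = q \<or> below x y a q \<and> z a < z q" if "q \<in> P" for q
    using that
  proof (induction "x q" arbitrary: q rule: less_induct)
    case less
    show ?case
    proof (cases "q \<in> A")
      case False
      then obtain q' where q': "q' \<in> P" "below x y q' q" "z q' < z q"
        using less.prems by (auto simp: A_def)
      then obtain a where "a \<in> A" "a = q' \<or> below x y a q' \<and> z a < z q'"
        using less.hyps[of q'] by (auto simp: below_def)
      with q' show ?thesis
        by (intro bexI[of _ a]) (auto simp: below_def)
    qed auto
  qed
  then obtain m where m: "\<And>q. q \<in> P \<Longrightarrow> m q \<in> A \<and> (m q = q \<or> below x y (m q) q \<and> z (m q) < z q)"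
    by metis
  define R where "R \<kappa> = {q \<in> P - A. c0 (m q) = \<kappa>}" for \<kappa>
  have "\<exists>c :: 'a \<Rightarrow> 'c. \<forall>X Y Z. card (octant_part x y z (R \<kappa>) X Y Z) \<ge> threshold k \<longrightarrow>
           K - {\<kappa>} \<subseteq> c ` octant_part x y z (R \<kappa>) X Y Z" if "\<kappa> \<in> K" for \<kappa>
  proof -
    have k: "k = card (K - {\<kappa>})"
      using that Suc.hyps(2) Suc.prems(5) by simp
    have "R \<kappa> \<subseteq> P"
      by (auto simp: R_def)
    then have "finite (R \<kappa>)" "inj_on x (R \<kappa>)" "inj_on y (R \<kappa>)" "inj_on z (R \<kappa>)"
      using Suc.prems by (auto intro: inj_on_subset finite_subset)
    from Suc.hyps(1)[OF k this] show ?thesis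
      using Suc.prems(5) k by simp
  qed
  then obtain cR :: "'c \<Rightarrow> 'a \<Rightarrow> 'c" where cR: "\<And>\<kappa> X Y Z. \<kappa> \<in> K \<Longrightarrow>
      card (octant_part x y z (R \<kappa>) X Y Z) \<ge> threshold k \<Longrightarrow>
      K - {\<kappa>} \<subseteq> cR \<kappa> ` octant_part x y z (R \<kappa>) X Y Z"
    by metis
  define c where "c q = (if q \<in> A then c0 q else cR (c0 (m q)) q)" for q
  have "K \<subseteq> c ` octant_part x y z P X Y Z"
    if large: "card (octant_part x y z P X Y Z) \<ge> threshold (Suc k)" for X Y Z
  proof -
    let ?O = "\<lambda>P. octant_part x y z P X Y Z"
    have sub: "?O A \<subseteq> ?O P" "?O (R \<kappa>) \<subseteq> ?O P" for \<kappa>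
      by (auto simp: octant_part_def A_def R_def)
    show ?thesis
    proof (cases "card (?O A) \<ge> 12 ^ (2 ^ k - 1)")
      case True
      then have "K \<subseteq> c0 ` ?O A"
        by (rule c0(2))
      also have "c0 ` ?O A = c ` ?O A"
        by (auto simp: c_def octant_part_def)
      finally show ?thesis
        using sub by blast
    next
      case False
      have "\<exists>\<kappa>\<in>K. card (?O (R \<kappa>)) \<ge> threshold k"
      proof (rule ccontr)
        assume neg: "\<not> ?thesis"
        have "q \<in> (\<Union>\<kappa>\<in>K. ?O (R \<kappa>))" if "q \<in> ?O P" "q \<notin> ?O A" for q
        proof -
          have "q \<in> P - A"
            using that by (auto simp: octant_part_def)
          moreover from this have "c0 (m q) \<in> K"
            using m c0(1) by blast
          ultimately show ?thesis
            using that by (auto simp: octant_part_def R_def)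
        qed
        then have "?O P = ?O A \<union> (\<Union>\<kappa>\<in>K. ?O (R \<kappa>))"
          using sub by blast
        then have "card (?O P) \<le> card (?O A) + card (\<Union>\<kappa>\<in>K. ?O (R \<kappa>))"
          by (metis card_Un_le)
        also have "card (\<Union>\<kappa>\<in>K. ?O (R \<kappa>)) \<le> (\<Sum>\<kappa>\<in>K. card (?O (R \<kappa>)))"
          by (rule card_UN_le[OF Suc.prems(5)])
        also have "\<dots> \<le> (\<Sum>\<kappa>\<in>K. threshold k - 1)"
          using neg by (intro sum_mono) force
        also have "\<dots> = Suc k * (threshold k - 1)"
          using Suc.hyps(2) by simp
        finally show False
          using large False threshold.simps(2)[of k] by linarith
      qed
      then obtain \<kappa> where \<kappa>: "\<kappa> \<in> K" "card (?O (R \<kappa>)) \<ge> threshold k"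
        by blast
      then have "K - {\<kappa>} \<subseteq> cR \<kappa> ` ?O (R \<kappa>)"
        by (rule cR)
      also have "cR \<kappa> ` ?O (R \<kappa>) = c ` ?O (R \<kappa>)"
        by (rule image_cong) (auto simp: c_def octant_part_def R_def)
      finally have "K - {\<kappa>} \<subseteq> c ` ?O P"
        using sub by blast
      moreover have "\<kappa> \<in> c ` ?O P"
      \<comment> \<open>Octants are closed downwards, so the minimal point \<open>m q\<close> of
        color \<kappa> lies in every octant containing \<open>q\<close>.\<close>
      proof -
        have "?O (R \<kappa>) \<noteq> {}"
          using \<kappa>(2) threshold_pos[of k] by auto
        then obtain q where q: "q \<in> ?O (R \<kappa>)"
          by blast
        then have "q \<in> P" "c0 (m q) = \<kappa>"
          by (auto simp: octant_part_def R_def)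
        moreover have "m q \<in> ?O P" "m q \<in> A"
          using m[OF \<open>q \<in> P\<close>] q by (auto simp: octant_part_def A_def below_def)
        ultimately show ?thesis
          by (metis c_def imageI)
      qed
      ultimately show ?thesis
        by blast
    qed
  qed
  then show ?case
    unfolding Suc.hyps(2)[symmetric] by (intro exI[of _ c] allI impI)
qed

section \<open>Octants in space\<close>

text \<open>Ties in \<open>f\<close> are broken by a numbering of \<open>P\<close>. Each set of
  points with \<open>f p \<le> a\<close> is still an initial segment of the refined order, so its
  cardinality serves as the bound on ranks.\<close>

lemma ex_injective_rank:
  fixes f :: "'a \<Rightarrow> real"
  assumes "finite P"
  shows "\<exists>r :: 'a \<Rightarrow> nat. inj_on r P \<and> (\<forall>a. \<exists>n. \<forall>p\<in>P. f p \<le> a \<longleftrightarrow> r p < n)"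
proof -
  obtain idx :: "'a \<Rightarrow> nat" where idx: "inj_on idx P"
    using assms finite_imp_inj_to_nat_seg by blast
  define before where "before p = {q\<in>P. f q < f p \<or> f q = f p \<and> idx q < idx p}" for p
  define r where "r p = card (before p)" for p
  have fin: "finite (before p)" for p
    using assms by (simp add: before_def)
  have mono: "r p < r q" if "p \<in> P" "p \<in> before q" for p q
  proof -
    have "before p \<subset> before q"
      using that by (auto simp: before_def)
    then show ?thesis
      unfolding r_def by (intro psubset_card_mono fin)
  qed
  have "p = q" if "p \<in> P" "q \<in> P" "r p = r q" for p q
  proof (rule ccontr)
    assume "p \<noteq> q"
    then have "idx p \<noteq> idx q"
      using that idx by (auto simp: inj_on_def)
    then have "p \<in> before q \<or> q \<in> before p"
      using that by (auto simp: before_def)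
    then show False
      using mono that by fastforce
  qed
  moreover have "f p \<le> a \<longleftrightarrow> r p < card {q\<in>P. f q \<le> a}" if p: "p \<in> P" for p a
  proof
    assume "f p \<le> a"
    then have "before p \<subset> {q\<in>P. f q \<le> a}"
      using p by (auto simp: before_def)
    then show "r p < card {q\<in>P. f q \<le> a}"
      unfolding r_def using assms by (intro psubset_card_mono) auto
  next
    assume *: "r p < card {q\<in>P. f q \<le> a}"
    show "f p \<le> a"
    proof (rule ccontr)
      assume "\<not> ?thesis"
      then have "{q\<in>P. f q \<le> a} \<subseteq> before p"
        by (auto simp: before_def)
      then have "card {q\<in>P. f q \<le> a} \<le> r p"
        unfolding r_def by (intro card_mono fin)
      with * show False by simp
    qed
  qed
  ultimately show ?thesis
    by (intro exI[of _ r]) (auto intro: inj_onI)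
qed

theorem theorem4:
  fixes Oct :: "(real ^ 3) set" and k :: nat and P :: "(real ^ 3) set"
  assumes "is_octant Oct" and "k \<ge> 2" and "finite P"
  shows "\<exists>c. is_coloring k P c \<and>
           (\<forall>v. card (P \<inter> translate Oct v) \<ge> 12 ^ (2 ^ (k - 1) + 2 ^ (k - 2) - 2) \<longrightarrow>
                (\<forall>j<k. \<exists>p \<in> P \<inter> translate Oct v. c p = j))"
proof -
  obtain \<epsilon> :: "3 \<Rightarrow> real" where Oct: "Oct = {x. \<forall>i. \<epsilon> i * x $ i \<ge> 0}"
    using assms(1) by (auto simp: is_octant_def)
  \<comment> \<open>The minus sign turns the lower bounds defining the octant into upper bounds, as
    initial segments require.\<close>
  have "\<exists>r :: real^3 \<Rightarrow> nat. inj_on r P \<and> (\<forall>a. \<exists>n. \<forall>p\<in>P. - \<epsilon> i * p $ i \<le> a \<longleftrightarrow> r p < n)" for i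
    by (rule ex_injective_rank[OF assms(3)])
  then obtain r :: "3 \<Rightarrow> real^3 \<Rightarrow> nat" where inj: "\<And>i. inj_on (r i) P"
    and "\<forall>i a. \<exists>n. \<forall>p\<in>P. - \<epsilon> i * p $ i \<le> a \<longleftrightarrow> r i p < n"
    by metis
  then obtain n where n: "\<And>i a p. p \<in> P \<Longrightarrow> - \<epsilon> i * p $ i \<le> a \<longleftrightarrow> r i p < n i a"
    by metis
  obtain c :: "real^3 \<Rightarrow> nat" where c: "\<And>X Y Z.
      card (octant_part (r 1) (r 2) (r 3) P X Y Z) \<ge> threshold (card {..<k}) \<Longrightarrow>
      {..<k} \<subseteq> c ` octant_part (r 1) (r 2) (r 3) P X Y Z"
    using polychromatic[OF assms(3) inj inj inj finite_lessThan[of k], of 1 2 3] by blast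
  \<comment> \<open>The coloring \<open>c\<close> is only known to show all required colors; values
    outside the palette are reset to 0.\<close>
  define c' where "c' p = (if c p < k then c p else 0)" for p
  have "\<exists>p \<in> P \<inter> translate Oct v. c' p = j"
    if large: "card (P \<inter> translate Oct v) \<ge> 12 ^ (2 ^ (k - 1) + 2 ^ (k - 2) - 2)" and j: "j < k" for v j
  proof -
    let ?n = "\<lambda>i. n i (- \<epsilon> i * v $ i)"
    have "p \<in> translate Oct v \<longleftrightarrow> (\<forall>i. r i p < ?n i)" if "p \<in> P" for p
    proof -
      have "p \<in> translate Oct v \<longleftrightarrow> p - v \<in> Oct"
        unfolding translate_def by (metis (no_types, lifting) diff_add_cancel add_diff_cancel image_iff)
      also have "\<dots> \<longleftrightarrow> (\<forall>i. - \<epsilon> i * p $ i \<le> - \<epsilon> i * v $ i)"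
        by (simp add: Oct right_diff_distrib)
      also have "\<dots> \<longleftrightarrow> (\<forall>i. r i p < ?n i)"
        by (simp only: n[OF that])
      finally show ?thesis .
    qed
    then have eq: "P \<inter> translate Oct v = octant_part (r 1) (r 2) (r 3) P (?n 1) (?n 2) (?n 3)"
      by (auto simp: octant_part_def forall_3)
    have "threshold (card {..<k}) \<le> card (P \<inter> translate Oct v)"
      using threshold_le[OF assms(2)] large by simp
    then have "{..<k} \<subseteq> c ` (P \<inter> translate Oct v)"
      unfolding eq by (rule c)
    then obtain p where "p \<in> P \<inter> translate Oct v" "c p = j"
      using j by blast
    then show ?thesis
      using j by (auto simp: c'_def)
  qed
  moreover have "is_coloring k P c'"
    using assms(2) by (auto simp: is_coloring_def c'_def)
  ultimately show ?thesis
    by (intro exI[of _ c'] conjI allI impI)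
qed

end
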